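(* Consider the optimization problem $$\min_{(\mathcal M,\mathcal X)} \ \mathrm{Trace}(\mathcal M\,\mathcal B(\mathcal X))\quad\text{s.t.}\quad \mathcal X\in\mathcal D_L,\quad \mathcal A(\mathcal X)^T\mathcal M+\mathcal M\mathcal A(\mathcal X)+\mathcal C=0,$$ with Lagrangian $$\Gamma(\mathcal W,\mathcal M,\mathcal X)=\mathrm{Trace}(\mathcal M\,\mathcal B(\mathcal X))+\mathrm{Trace}\big(\mathcal W(\mathcal A(\mathcal X)^T\mathcal M+\mathcal M\mathcal A(\mathcal X)+\mathcal C)\big),$$ where $\mathcal W,\mathcal M$ are symmetric $(n+\nu)\times(n+\nu)$ real matrices and $\mathcal X\in\mathbb R^{\nu\times(\nu+m)}$. The KKT system $\nabla\Gamma(\mathcal W,\mathcal M,\mathcal X)=0$ of this problem is given by $$\nabla\Gamma(\mathcal W,\mathcal M,\mathcal X)=0\iff\begin{cases}\mathcal A(\mathcal X)^T\mathcal M+\mathcal M\mathcal A(\mathcal X)+\mathcal C=0,\\ \mathcal A(\mathcal X)\mathcal W+\mathcal W\mathcal A(\mathcal X)^T+\mathcal B(\mathcal X)=0,\\ M_{12}^TB\mathcal E^T+M_{22}\mathcal X\mathcal E\mathcal E^T+M_{12}^TW_{12}\mathcal L^T+M_{22}W_{22}\mathcal L^T=0.\end{cases}$$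
   Context: Let $A\in\mathbb R^{n\times n}$, $B\in\mathbb R^{n\times m}$, $C\in\mathbb R^{p\times n}$ be a minimal realization of a linear time-invariant system $\dot x=Ax+Bu$, $y=Cx$, with $A$ stable: $\sigma(A)\subset\mathbb C^-$ ($\sigma$ is the spectrum, $\mathbb C^-$ the open left half plane). Fix $L\in\mathbb R^{m\times\nu}$ and a matrix $\Pi\in\mathbb R^{n\times\nu}$ of the form $\Pi=VT$, with $V=[(s_1I-A)^{-1}B\ \cdots\ (s_\nu I-A)^{-1}B]$ (for $m>1$, columns taken along directions $\ell_i\in\mathbb{R}^m$) the right Krylov projection matrix at interpolation points $s_i\notin\sigma(A)$ and $T$ nonsingular; in all formulas $\Pi$ is a fixed constant matrix, not depending on $\mathcal X$. The variable is $\mathcal X=[S\ \ G]\in\mathbb R^{\nu\times(\nu+m)}$ with $S\in\mathbb R^{\nu\times\nu}$, $G\in\mathbb R^{\nu\times m}$. Put $$\mathcal L=\begin{bmatrix}I_\nu\\ -L\end{bmatrix},\qquad \mathcal E=\begin{bmatrix}0_{\nu\times m}\\ I_m\end{bmatrix},$$ where, corrected to conform with $\mathcal X$, the zero block of $\mathcal E$ has size $\nu\times m$, so that $G=\mathcal X\mathcal E$ and $S-GL=\mathcal X\mathcal L$. Define $$\mathcal A(\mathcal X)=\begin{bmatrix}A&0\\ 0&\mathcal X\mathcal L\end{bmatrix},\quad \mathcal B(\mathcal X)=\begin{bmatrix}B\\ \mathcal X\mathcal E\end{bmatrix}\begin{bmatrix}B\\ \mathcal X\mathcal E\end{bmatrix}^T,\quad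 \mathcal C=\begin{bmatrix}I\\ -\Pi^T\end{bmatrix}C^TC\begin{bmatrix}I&-\Pi\end{bmatrix},$$ and $\mathcal D_L=\{\mathcal X:\sigma(\mathcal X\mathcal L)\subset\mathbb C^-\}$. Symmetric $(n+\nu)\times(n+\nu)$ matrices are partitioned as $\mathcal W=\begin{bmatrix}W_{11}&W_{12}\\ W_{12}^T&W_{22}\end{bmatrix}$, $\mathcal M=\begin{bmatrix}M_{11}&M_{12}\\ M_{12}^T&M_{22}\end{bmatrix}$ with $W_{11},M_{11}\in\mathbb R^{n\times n}$ and $W_{22},M_{22}\in\mathbb R^{\nu\times\nu}$. $\nabla\Gamma=(\nabla_{\mathcal W}\Gamma,\nabla_{\mathcal M}\Gamma,\nabla_{\mathcal X}\Gamma)$ denotes the gradient with respect to the trace inner product $\langle U,V\rangle=\mathrm{Trace}(U^TV)$. *)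

theory Defs
  imports "HOL-Analysis.Analysis"
begin

section \<open>Block matrices\<close>

text \<open>Block matrices are indexed by sum types, so that an $(n+\nu)\times(n+\nu)$ matrix has type
  \<^typ>\<open>real^('n+'v)^('n+'v)\<close>. Recall that \<^typ>\<open>'a^'c^'r\<close> has rows indexed by
  \<^typ>\<open>'r\<close> and columns by \<^typ>\<open>'c\<close>.\<close>

definition block_row :: "'a^'c1^'r \<Rightarrow> 'a^'c2^'r \<Rightarrow> 'a^('c1+'c2)^'r" where
  "block_row P Q = (\<chi> i j. case j of Inl a \<Rightarrow> P $ i $ a | Inr b \<Rightarrow> Q $ i $ b)"

definition block_col :: "'a^'c^'r1 \<Rightarrow> 'a^'c^'r2 \<Rightarrow> 'a^'c^('r1+'r2)" where
  "block_col P Q = (\<chi> i. case i of Inl a \<Rightarrow> P $ a | Inr b \<Rightarrow> Q $ b)"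

definition four_block ::
  "'a^'c1^'r1 \<Rightarrow> 'a^'c2^'r1 \<Rightarrow> 'a^'c1^'r2 \<Rightarrow> 'a^'c2^'r2 \<Rightarrow> 'a^('c1+'c2)^('r1+'r2)" where
  "four_block P Q R S = block_col (block_row P Q) (block_row R S)"

definition block12 :: "'a^('c1::finite+'c2)^('r1+'r2::finite) \<Rightarrow> 'a^'c2^'r1" where
  "block12 M = (\<chi> i j. M $ Inl i $ Inr j)"

definition block22 :: "'a^('c1::finite+'c2)^('r1::finite+'r2) \<Rightarrow> 'a^'c2^'r2" where
  "block22 M = (\<chi> i j. M $ Inr i $ Inr j)"

definition sym_matrices :: "(real^'k^'k) set" where
  "sym_matrices = {M. transpose M = M}"

lemma subspace_sym_matrices: "subspace (sym_matrices :: (real^'k^'k) set)"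
  by (auto simp: subspace_def sym_matrices_def transpose_def vec_eq_iff)


section \<open>Linear systems\<close>

abbreviation cmat :: "real^'c^'r \<Rightarrow> complex^'c^'r" where
  "cmat \<equiv> map_matrix complex_of_real"

definition spectrum :: "real^'k^'k \<Rightarrow> complex set" where
  "spectrum A = {z. \<not> invertible (mat z - cmat A)}"

definition stable_matrix :: "real^'k^'k \<Rightarrow> bool" where
  "stable_matrix A \<longleftrightarrow> spectrum A \<subseteq> {z. Re z < 0}"

definition transfer_function ::
  "real^'n^'n \<Rightarrow> real^'m^'n \<Rightarrow> real^'n^'p \<Rightarrow> complex \<Rightarrow> complex^'m^'p" where
  "transfer_function A B C z = cmat C ** matrix_inv (mat z - cmat A) ** cmat B"

text \<open>Minimality: no system with fewer states has the same transfer function. Since a type cannot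
  be quantified over, a system of order $k < n$ is represented by its zero-padding, i.e. by
  matrices of the original sizes that are supported on a proper subset of $k$ state indices;
  padding changes the transfer function at most by a removable point at \<open>0\<close>.\<close>

definition supported_on ::
  "'n set \<Rightarrow> real^'n^'n \<Rightarrow> real^'m^'n \<Rightarrow> real^'n^'p \<Rightarrow> bool" where
  "supported_on I A B C \<longleftrightarrow>
     (\<forall>i j. i \<notin> I \<or> j \<notin> I \<longrightarrow> A $ i $ j = 0) \<and>
     (\<forall>i j. i \<notin> I \<longrightarrow> B $ i $ j = 0) \<and>
     (\<forall>i j. j \<notin> I \<longrightarrow> C $ i $ j = 0)"

definition minimal_realization :: "real^'n^'n \<Rightarrow> real^'m^'n \<Rightarrow> real^'n^'p \<Rightarrow> bool" where
  "minimal_realization A B C \<longleftrightarrow>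
     \<not> (\<exists>I A' B' C'. I \<subset> UNIV \<and> supported_on I A' B' (C' :: real^'n^'p) \<and>
          (\<forall>z. z \<notin> spectrum A \<and> z \<notin> spectrum A' \<longrightarrow>
             transfer_function A' B' C' z = transfer_function A B C z))"

text \<open>The matrix with columns $(s_j I - A)^{-1} B \ell_j$. The interpolation points may be complex;
  the case $m = 1$ of undirected columns is $\ell_j = 1$.\<close>

definition krylov ::
  "real^'n^'n \<Rightarrow> real^'m^'n \<Rightarrow> ('v \<Rightarrow> complex) \<Rightarrow> ('v \<Rightarrow> real^'m) \<Rightarrow> complex^'v^'n" where
  "krylov A B s l =
     (\<chi> i j. (matrix_inv (mat (s j) - cmat A) *v (cmat B *v (\<chi> k. complex_of_real (l j $ k)))) $ i)"


section \<open>Gradients on subspaces\<close>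

text \<open>The gradient at \<open>x \<in> S\<close> of a function whose variable ranges over a linear subspace \<open>S\<close> (here:
  with symmetric matrix arguments); the gradient is an element of \<open>S\<close>. On matrices, \<open>\<bullet>\<close> is the
  trace inner product, and on tuples it is the sum of the componentwise inner products, so that
  the gradient of a function of several variables is the tuple of its partial gradients.\<close>

definition has_gradient_on :: "'a::real_inner set \<Rightarrow> ('a \<Rightarrow> real) \<Rightarrow> 'a \<Rightarrow> 'a \<Rightarrow> bool" where
  "has_gradient_on S f x D \<longleftrightarrow> D \<in> S \<and> (f has_derivative (\<lambda>h. D \<bullet> h)) (at x within S)"

definition gradient_on :: "'a::real_inner set \<Rightarrow> ('a \<Rightarrow> real) \<Rightarrow> 'a \<Rightarrow> 'a" where
  "gradient_on S f x = (THE D. has_gradient_on S f x D)"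

lemma inner_eq_trace: "U \<bullet> V = trace (transpose U ** V)" for U V :: "real^'c^'r"
  unfolding inner_vec_def trace_def matrix_matrix_mult_def transpose_def
  by (simp add: sum.swap[of _ "UNIV :: 'r set"])

lemma has_gradient_on_unique:
  assumes S: "subspace S" "x \<in> S"
    and D: "has_gradient_on S f x D" and D': "has_gradient_on S f x D'"
  shows "D = D'"
proof -
  define e where "e = D - D'"
  have e: "e \<in> S"
    using S D D' by (simp add: e_def has_gradient_on_def subspace_diff)
  have "((\<lambda>y. f y - f y) has_derivative (\<lambda>h. D \<bullet> h - D' \<bullet> h)) (at x within S)"
    using D D' unfolding has_gradient_on_def by (intro has_derivative_diff) auto
  hence z: "((\<lambda>y. 0::real) has_derivative (\<lambda>h. e \<bullet> h)) (at x within S)"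
    by (simp add: e_def inner_diff_left)
  have line: "((\<lambda>t. x + t *\<^sub>R e) has_derivative (\<lambda>t. t *\<^sub>R e)) (at (0::real))"
    by (auto intro!: derivative_eq_intros)
  have sub: "range (\<lambda>t::real. x + t *\<^sub>R e) \<subseteq> S"
    using S e by (auto intro: subspace_add subspace_scale)
  have "((\<lambda>y. 0::real) has_derivative (\<lambda>h. e \<bullet> h))
          (at (x + 0 *\<^sub>R e) within range (\<lambda>t::real. x + t *\<^sub>R e))"
    using has_derivative_subset[OF z sub] by simp
  hence "((\<lambda>t::real. 0::real) has_derivative (\<lambda>t. e \<bullet> (t *\<^sub>R e))) (at 0)"
    using has_derivative_in_compose[OF line, of "\<lambda>y. 0" "\<lambda>h. e \<bullet> h"] by simp
  hence "(\<lambda>t::real. e \<bullet> (t *\<^sub>R e)) = (\<lambda>t. 0)"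
    using has_derivative_unique has_derivative_const by blast
  hence "e \<bullet> (1 *\<^sub>R e) = 0" by meson
  thus ?thesis by (simp add: e_def)
qed

lemma has_gradient_on_exists:
  fixes S :: "'a::euclidean_space set"
  assumes S: "subspace S" "x \<in> S" and f: "f differentiable (at x within S)"
  shows "\<exists>D. has_gradient_on S f x D"
proof -
  obtain f' where f': "(f has_derivative f') (at x within S)"
    using f by (auto simp: differentiable_def)
  interpret bounded_linear f' by (rule has_derivative_bounded_linear[OF f'])
  define d where "d = (\<Sum>b\<in>Basis. f' b *\<^sub>R b)"
  have d: "f' h = d \<bullet> h" for h
  proof -
    have "f' h = f' (\<Sum>b\<in>Basis. (h \<bullet> b) *\<^sub>R b)" by (simp add: euclidean_representation)
    also have "\<dots> = d \<bullet> h"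
      by (simp add: d_def sum scaleR inner_sum_left mult.commute inner_commute[of h])
    finally show ?thesis .
  qed
  obtain y z where y: "y \<in> span S" and z: "\<And>w. w \<in> span S \<Longrightarrow> orthogonal z w" and "d = y + z"
    using orthogonal_subspace_decomp_exists[of S d] by metis
  hence eq: "f' h = y \<bullet> h" if "h \<in> S" for h
    using that S d[of h] z[of h]
    by (simp add: inner_add_left orthogonal_def span_base)
  have "(f has_derivative (\<lambda>h. y \<bullet> h)) (at x within S)"
  proof -
    have "\<forall>\<^sub>F w in at x within S. (f w - f x - f' (w - x)) /\<^sub>R norm (w - x)
        = (f w - f x - y \<bullet> (w - x)) /\<^sub>R norm (w - x)"
      using S by (auto simp: eventually_at_filter eq subspace_diff)
    with f' show ?thesis
      unfolding has_derivative_within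
      by (auto intro: bounded_linear_inner_right Lim_transform_eventually simp: divide_inverse)
  qed
  thus ?thesis
    using y S by (auto simp: has_gradient_on_def span_eq_iff[THEN iffD2])
qed


section \<open>The optimization problem and its Lagrangian\<close>

definition LL :: "real^'v^'m \<Rightarrow> real^'v^('v+'m)" where
  "LL L = block_col (mat 1) (- L)"

definition EE :: "real^'m^('v::finite+'m)" where
  "EE = block_col 0 (mat 1)"

definition AA :: "real^'n^'n \<Rightarrow> real^'v^'m \<Rightarrow> real^('v+'m)^'v \<Rightarrow> real^('n+'v)^('n+'v)" where
  "AA A L X = four_block A 0 0 (X ** LL L)"

definition BB :: "real^'m^'n \<Rightarrow> real^('v+'m)^'v \<Rightarrow> real^('n+'v)^('n+'v)" where
  "BB B X = block_col B (X ** EE) ** transpose (block_col B (X ** EE))"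

definition CC :: "real^'n^'p \<Rightarrow> real^'v^'n \<Rightarrow> real^('n+'v)^('n+'v)" where
  "CC C P = block_col (mat 1) (- transpose P) ** transpose C ** C ** block_row (mat 1) (- P)"

definition D_L :: "real^'v^'m \<Rightarrow> (real^('v+'m)^'v) set" where
  "D_L L = {X. stable_matrix (X ** LL L)}"

definition objective ::
  "real^'m^'n \<Rightarrow> real^('n+'v)^('n+'v) \<Rightarrow> real^('v+'m)^'v \<Rightarrow> real" where
  "objective B M X = trace (M ** BB B X)"

definition lyap_constraint ::
  "real^'n^'n \<Rightarrow> real^'n^'p \<Rightarrow> real^'v^'m \<Rightarrow> real^'v^'n \<Rightarrow>
     real^('n+'v)^('n+'v) \<Rightarrow> real^('v+'m)^'v \<Rightarrow> real^('n+'v)^('n+'v)" where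
  "lyap_constraint A C L P M X = transpose (AA A L X) ** M + M ** AA A L X + CC C P"

text \<open>The problem is to minimize \<^const>\<open>objective\<close> over the following set. Its Lagrangian
  dualizes the equality constraint only; the constraint \<open>X \<in> D_L L\<close> is open.\<close>

definition feasible_set ::
  "real^'n^'n \<Rightarrow> real^'n^'p \<Rightarrow> real^'v^'m \<Rightarrow> real^'v^'n \<Rightarrow>
     ((real^('n+'v)^('n+'v)) \<times> (real^('v+'m)^'v)) set" where
  "feasible_set A C L P =
     {(M, X). M \<in> sym_matrices \<and> X \<in> D_L L \<and> lyap_constraint A C L P M X = 0}"

definition lagrangian ::
  "real^'n^'n \<Rightarrow> real^'m^'n \<Rightarrow> real^'n^'p \<Rightarrow> real^'v^'m \<Rightarrow> real^'v^'n \<Rightarrow>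
     (real^('n+'v)^('n+'v)) \<times> (real^('n+'v)^('n+'v)) \<times> (real^('v+'m)^'v) \<Rightarrow> real" where
  "lagrangian A B C L P =
     (\<lambda>(W, M, X). objective B M X + trace (W ** lyap_constraint A C L P M X))"

abbreviation grad_lagrangian ::
  "real^'n^'n \<Rightarrow> real^'m^'n \<Rightarrow> real^'n^'p \<Rightarrow> real^'v^'m \<Rightarrow> real^'v^'n \<Rightarrow>
     (real^('n+'v)^('n+'v)) \<times> (real^('n+'v)^('n+'v)) \<times> (real^('v+'m)^'v) \<Rightarrow>
     (real^('n+'v)^('n+'v)) \<times> (real^('n+'v)^('n+'v)) \<times> (real^('v+'m)^'v)" where
  "grad_lagrangian A B C L P \<equiv>
     gradient_on (sym_matrices \<times> sym_matrices \<times> UNIV) (lagrangian A B C L P)"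

end

theory Submission
  imports Defs
begin

text \<open>The Lagrangian is a polynomial in \<open>(W, M, X)\<close>. Moving every matrix factor across the trace
  inner product with its adjoint, and using the symmetry of \<open>W\<close> and \<open>M\<close>, turns its derivative
  into \<open>R\<^sub>1 \<bullet> dW + R\<^sub>2 \<bullet> dM + 2 (R\<^sub>3 \<bullet> dX)\<close>, where \<open>R\<^sub>1\<close>, \<open>R\<^sub>2\<close>, \<open>R\<^sub>3\<close> are the three residuals of
  the KKT system. As \<open>R\<^sub>1\<close> and \<open>R\<^sub>2\<close> are symmetric, \<open>(R\<^sub>1, R\<^sub>2, 2 R\<^sub>3)\<close> is the gradient.\<close>

section \<open>Calculus of matrix products, transposes and traces\<close>

lemma matrix_add_rdistrib: "(U + V) ** K = U ** K + V ** K"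
  for U V :: "real^'n^'m" and K :: "real^'p^'n"
  by (simp add: vec_eq_iff matrix_matrix_mult_def algebra_simps sum.distrib)

text \<open>In finite dimension bilinearity already implies boundedness; this supplies the product
  rule for \<open>**\<close>.\<close>

lemma bounded_bilinear_matrix_mult:
  "bounded_bilinear ((**) :: real^'n^'m \<Rightarrow> real^'p^'n \<Rightarrow> real^'p^'m)"
  unfolding bilinear_conv_bounded_bilinear[symmetric] bilinear_def
  by (auto intro!: linearI simp: vec_eq_iff matrix_matrix_mult_def algebra_simps sum.distrib
      sum_distrib_left)

lemmas has_derivative_matrix_mult [derivative_intros] =
  bounded_bilinear.FDERIV[OF bounded_bilinear_matrix_mult]

lemma bounded_linear_transpose: "bounded_linear (transpose :: real^'n^'m \<Rightarrow> real^'m^'n)"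
  unfolding linear_conv_bounded_linear[symmetric]
  by (auto intro!: linearI simp: vec_eq_iff transpose_def)

lemmas has_derivative_transpose [derivative_intros] =
  bounded_linear.has_derivative[OF bounded_linear_transpose]

lemma bounded_linear_trace: "bounded_linear (trace :: real^'n^'n \<Rightarrow> real)"
  unfolding linear_conv_bounded_linear[symmetric]
  by (auto intro!: linearI simp: trace_def sum.distrib sum_distrib_left)

lemmas has_derivative_trace [derivative_intros] =
  bounded_linear.has_derivative[OF bounded_linear_trace]

section \<open>Adjoints for the trace inner product\<close>

lemma transpose_add: "transpose (U + V) = transpose U + transpose V"
  for U V :: "real^'n^'m"
  by (simp add: vec_eq_iff transpose_def)

lemma inner_transpose: "transpose U \<bullet> V = U \<bullet> transpose V"
  for U :: "real^'n^'m"
  unfolding inner_vec_def by (simp add: transpose_def sum.swap[of _ "UNIV :: 'm set"])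

lemma trace_mult_eq_inner: "trace (U ** V) = transpose U \<bullet> V"
  for U :: "real^'n^'m"
  by (simp add: inner_eq_trace)

text \<open>Both sides are the trace of \<open>transpose U ** K ** H\<close>.\<close>

lemma inner_matrix_mult_left: "U \<bullet> (K ** H) = (transpose K ** U) \<bullet> H"
  for U :: "real^'n^'m"
  by (simp add: inner_eq_trace matrix_transpose_mul matrix_mul_assoc)

text \<open>Transposition preserves the inner product and reverses products, which reduces the claim
  to multiplication on the left.\<close>

lemma inner_matrix_mult_right: "U \<bullet> (H ** K) = (U ** transpose K) \<bullet> H"
  for U :: "real^'n^'m"
proof -
  have "U \<bullet> (H ** K) = transpose U \<bullet> (transpose K ** transpose H)"
    by (simp add: inner_transpose matrix_transpose_mul)
  also have "\<dots> = transpose (U ** transpose K) \<bullet> transpose H"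
    by (simp add: inner_matrix_mult_left matrix_transpose_mul)
  finally show ?thesis by (simp add: inner_transpose)
qed

section \<open>Block matrices and their symmetric products\<close>

lemma sum_UNIV_Plus: "(\<Sum>k\<in>UNIV. f k) = (\<Sum>a\<in>UNIV. f (Inl a)) + (\<Sum>b\<in>UNIV. f (Inr b))"
  for f :: "'a::finite + 'b::finite \<Rightarrow> 'c::comm_monoid_add"
  using sum.Plus[of "UNIV :: 'a set" "UNIV :: 'b set" f] by simp

text \<open>The adjoint of the zero padding \<open>block_col 0\<close>; in the same way
  \<open>block22\<close> is the adjoint of \<open>four_block 0 0 0\<close>.\<close>

definition lower_rows :: "'a^'c^('r1::finite+'r2::finite) \<Rightarrow> 'a^'c^'r2" where
  "lower_rows U = (\<chi> i. U $ Inr i)"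

lemma inner_block_col_zero: "U \<bullet> block_col 0 Y = lower_rows U \<bullet> Y"
  for U :: "real^'c^('r1::finite+'r2::finite)"
  by (simp add: inner_vec_def sum_UNIV_Plus block_col_def lower_rows_def)

lemma inner_four_block_zero: "U \<bullet> four_block 0 0 0 Y = block22 U \<bullet> Y"
  for U :: "real^('c1::finite+'c2::finite)^('r1::finite+'r2::finite)"
  by (simp add: inner_vec_def sum_UNIV_Plus four_block_def block_col_def block_row_def
      block22_def)

lemma bounded_linear_block_col_zero:
  "bounded_linear (block_col 0 :: real^'c^'r2 \<Rightarrow> real^'c^('r1::finite+'r2))"
  unfolding linear_conv_bounded_linear[symmetric]
  by (auto intro!: linearI simp: vec_eq_iff block_col_def split: sum.split)

lemma bounded_linear_four_block_zero:
  "bounded_linear (four_block 0 0 0 :: real^'c2^'r2 \<Rightarrow> real^('c1::finite+'c2)^('r1::finite+'r2))"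
  unfolding linear_conv_bounded_linear[symmetric]
  by (auto intro!: linearI simp: vec_eq_iff four_block_def block_col_def block_row_def
      split: sum.split)

text \<open>Separates the constant block from the one that varies with \<open>X\<close>, so that an
  affine map can be differentiated through its linear part.\<close>

lemma block_col_add: "block_col U 0 + block_col 0 Y = block_col U Y"
  for U :: "real^'c^'r1" and Y :: "real^'c^'r2"
  by (auto simp: vec_eq_iff block_col_def split: sum.split)

lemma four_block_add: "four_block U 0 0 0 + four_block 0 0 0 Y = four_block U 0 0 Y"
  for U :: "real^'c1^'r1" and Y :: "real^'c2^'r2"
  by (auto simp: vec_eq_iff four_block_def block_col_def block_row_def split: sum.split)

lemma sym_matricesD: "U \<in> sym_matrices \<Longrightarrow> transpose U = U"
  by (simp add: sym_matrices_def)

lemma sym_matrices_nth: "U \<in> sym_matrices \<Longrightarrow> U $ i $ j = U $ j $ i"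
  by (auto simp: sym_matrices_def vec_eq_iff transpose_def)

text \<open>The lower rows of \<open>M\<close> start with its lower left block, which by symmetry is
  \<open>transpose (block12 M)\<close>. This is the origin of the transposed blocks in the third KKT
  equation.\<close>

lemma lower_rows_sym_mult:
  assumes "M \<in> sym_matrices"
  shows "lower_rows (M ** block_col U Y) = transpose (block12 M) ** U + block22 M ** Y"
  by (simp add: sym_matrices_nth[OF assms, of "Inr _" "Inl _"] vec_eq_iff lower_rows_def
      matrix_matrix_mult_def sum_UNIV_Plus block_col_def block12_def block22_def transpose_def)

lemma block22_sym_mult:
  assumes "M \<in> sym_matrices"
  shows "block22 (M ** W) = transpose (block12 M) ** block12 W + block22 M ** block22 W"
  by (simp add: sym_matrices_nth[OF assms, of "Inr _" "Inl _"] vec_eq_iff matrix_matrix_mult_def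
      sum_UNIV_Plus block12_def block22_def transpose_def)

lemma BB_sym: "transpose (BB B X) = BB B X"
  by (simp add: BB_def matrix_transpose_mul)

text \<open>The outer factors are transposes of each other, so the matrix is the Gram matrix of
  \<open>C ** block_row (mat 1) (- P)\<close>.\<close>

lemma CC_sym: "transpose (CC C P) = CC C P"
proof -
  have "transpose (block_col (mat 1) (- transpose P)) = block_row (mat 1) (- P)"
    by (auto simp: vec_eq_iff transpose_def block_col_def block_row_def mat_def split: sum.split)
  moreover from this have "transpose (block_row (mat 1) (- P)) = block_col (mat 1) (- transpose P)"
    by (metis transpose_transpose)
  ultimately show ?thesis
    by (simp add: CC_def matrix_transpose_mul matrix_mul_assoc)
qed

text \<open>The map is affine in \<open>X\<close>, so its derivative is the linear part and does not
  depend on \<open>X\<close>.\<close>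

lemma has_derivative_AA:
  "(AA A L has_derivative (\<lambda>H. four_block 0 0 0 (H ** LL L))) (at X within S)"
proof -
  have "bounded_linear (\<lambda>X. four_block 0 0 0 (X ** LL L))"
    by (rule bounded_linear_compose[OF bounded_linear_four_block_zero
          bounded_bilinear.bounded_linear_left[OF bounded_bilinear_matrix_mult]])
  from has_derivative_add[OF has_derivative_const[of "four_block A 0 0 0"]
      bounded_linear_imp_has_derivative[OF this]]
  show ?thesis
    by (simp add: AA_def[abs_def] four_block_add)
qed

text \<open>Product rule for \<open>b ** transpose b\<close>, where \<open>b\<close> is affine in
  \<open>X\<close>.\<close>

lemma has_derivative_BB:
  "(BB B has_derivative (\<lambda>H. block_col B (X ** EE) ** transpose (block_col 0 (H ** EE))
      + block_col 0 (H ** EE) ** transpose (block_col B (X ** EE)))) (at X within S)"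
proof -
  have "bounded_linear (\<lambda>X. block_col 0 (X ** EE))"
    by (rule bounded_linear_compose[OF bounded_linear_block_col_zero
          bounded_bilinear.bounded_linear_left[OF bounded_bilinear_matrix_mult]])
  from has_derivative_add[OF has_derivative_const[of "block_col B 0"]
      bounded_linear_imp_has_derivative[OF this]]
  have "((\<lambda>X. block_col B (X ** EE)) has_derivative (\<lambda>H. block_col 0 (H ** EE)))
      (at X within S)"
    by (simp add: block_col_add)
  from has_derivative_matrix_mult[OF this has_derivative_transpose[OF this]]
  show ?thesis
    unfolding BB_def[abs_def] .
qed

lemma has_gradient_on_lagrangian:
  fixes A :: "real^'n^'n" and L :: "real^'v^'m"
    and W M :: "real^('n+'v)^('n+'v)" and X :: "real^('v+'m)^'v"
  assumes W: "W \<in> sym_matrices" and M: "M \<in> sym_matrices"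
  shows "has_gradient_on (sym_matrices \<times> sym_matrices \<times> UNIV) (lagrangian A B C L P) (W, M, X)
      (transpose (AA A L X) ** M + M ** AA A L X + CC C P,
       AA A L X ** W + W ** transpose (AA A L X) + BB B X,
       2 *\<^sub>R (transpose (block12 M) ** B ** transpose EE + block22 M ** X ** EE ** transpose EE
        + transpose (block12 M) ** block12 W ** transpose (LL L)
        + block22 M ** block22 W ** transpose (LL L)))"
    (is "has_gradient_on ?S _ _ (?R1, ?R2, 2 *\<^sub>R ?R3)")
proof -
  note [simp] = sym_matricesD[OF W] sym_matricesD[OF M]
  define F where "F = AA A L X"
  define b where "b = block_col B (X ** EE)"
  \<comment> \<open>\<open>dF\<close> and \<open>db\<close> are the derivatives of \<open>F\<close>
    and \<open>b\<close> with respect to \<open>X\<close>, as functions of the direction.\<close>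
  define dF where "dF = (\<lambda>H. four_block 0 0 0 (H ** LL L) :: real^('n+'v)^('n+'v))"
  define db where "db = (\<lambda>H :: real^('v+'m)^'v. block_col 0 (H ** EE) :: real^'m^('n+'v))"
  have snd2: "((\<lambda>z. snd (snd z)) has_derivative (\<lambda>h. snd (snd h))) (at (W, M, X) within ?S)"
    by (intro derivative_intros)
  have dAA: "((\<lambda>z. AA A L (snd (snd z))) has_derivative (\<lambda>h. dF (snd (snd h))))
      (at (W, M, X) within ?S)"
    unfolding dF_def by (rule has_derivative_compose[OF snd2 has_derivative_AA])
  have dBB: "((\<lambda>z. BB B (snd (snd z))) has_derivative
      (\<lambda>h. b ** transpose (db (snd (snd h))) + db (snd (snd h)) ** transpose b))
      (at (W, M, X) within ?S)"
    using has_derivative_compose[OF snd2 has_derivative_BB] by (simp add: db_def b_def)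
  \<comment> \<open>Projections replace the tuple pattern so that the derivative rules
    apply.\<close>
  have Lag: "lagrangian A B C L P = (\<lambda>z. trace (fst (snd z) ** BB B (snd (snd z)))
      + trace (fst z ** (transpose (AA A L (snd (snd z))) ** fst (snd z)
          + fst (snd z) ** AA A L (snd (snd z)) + CC C P)))"
    by (auto simp: lagrangian_def objective_def lyap_constraint_def)
  have der: "(lagrangian A B C L P has_derivative (\<lambda>h.
        trace (M ** (b ** transpose (db (snd (snd h))) + db (snd (snd h)) ** transpose b)
          + fst (snd h) ** BB B X)
        + trace (W ** (transpose F ** fst (snd h) + transpose (dF (snd (snd h))) ** M
            + (M ** dF (snd (snd h)) + fst (snd h) ** F)) + fst h ** ?R1)))
      (at (W, M, X) within ?S)"
    unfolding Lag
    by (rule derivative_eq_intros dAA dBB refl)+ (simp add: F_def)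
  \<comment> \<open>By symmetry of \<open>M\<close> and \<open>W\<close>, the two terms containing
    \<open>db\<close> contribute equally, as do the two containing \<open>dF\<close>: hence the
    factor 2.\<close>
  have dX: "trace (M ** (b ** transpose (db H) + db H ** transpose b))
        + trace (W ** (transpose (dF H) ** M + M ** dF H)) = (2 *\<^sub>R ?R3) \<bullet> H" for H
  proof -
    have "M \<bullet> (b ** transpose (db H)) = (M ** b) \<bullet> db H"
      by (simp add: inner_matrix_mult_left inner_transpose[symmetric] matrix_transpose_mul)
    then have "trace (M ** (b ** transpose (db H) + db H ** transpose b)) = 2 * ((M ** b) \<bullet> db H)"
      by (simp add: trace_mult_eq_inner inner_add_right inner_matrix_mult_right[of _ "db H"])
    moreover have "W \<bullet> (transpose (dF H) ** M) = (M ** W) \<bullet> dF H"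
      by (simp add: inner_matrix_mult_right inner_transpose[symmetric] matrix_transpose_mul)
    then have "trace (W ** (transpose (dF H) ** M + M ** dF H)) = 2 * ((M ** W) \<bullet> dF H)"
      by (simp add: trace_mult_eq_inner inner_add_right inner_matrix_mult_left[of _ M])
    \<comment> \<open>Since \<open>db\<close> and \<open>dF\<close> are zero padded, only the lower
      rows of \<open>M ** b\<close> and the lower right block of \<open>M ** W\<close> are seen; the
      adjoints of \<open>EE\<close> and \<open>LL L\<close> then isolate \<open>H\<close>.\<close>
    ultimately show ?thesis
      by (simp add: db_def dF_def b_def inner_block_col_zero inner_four_block_zero
          lower_rows_sym_mult[OF M] block22_sym_mult[OF M] inner_matrix_mult_right
          matrix_add_rdistrib matrix_mul_assoc inner_add_left)
  qed
  have dM: "trace (K ** BB B X) + trace (W ** (transpose F ** K + K ** F)) = ?R2 \<bullet> K" for K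
  proof -
    have "trace (K ** BB B X) = BB B X \<bullet> K"
      by (simp only: trace_mult_eq_inner inner_transpose BB_sym) (rule inner_commute)
    moreover have "trace (W ** (transpose F ** K + K ** F)) = (F ** W + W ** transpose F) \<bullet> K"
      by (simp add: trace_mult_eq_inner inner_add_right inner_add_left
          inner_matrix_mult_left[of _ "transpose F"] inner_matrix_mult_right[of _ K])
    ultimately show ?thesis
      by (simp add: inner_add_left F_def)
  qed
  have R1: "transpose ?R1 = ?R1"
    by (simp add: transpose_add matrix_transpose_mul CC_sym)
  have dW: "trace (K ** ?R1) = ?R1 \<bullet> K" for K
    by (simp only: trace_mult_eq_inner inner_transpose R1) (rule inner_commute)
  have "transpose ?R2 = ?R2"
    by (simp add: transpose_add matrix_transpose_mul BB_sym)
  \<comment> \<open>A gradient on a subspace must itself lie in that subspace, which here means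
    symmetry of the first two components.\<close>
  with R1 have mem: "(?R1, ?R2, 2 *\<^sub>R ?R3) \<in> ?S"
    by (simp add: sym_matrices_def)
  have "(lagrangian A B C L P has_derivative (\<lambda>h. (?R1, ?R2, 2 *\<^sub>R ?R3) \<bullet> h))
      (at (W, M, X) within ?S)"
  proof (rule has_derivative_eq_rhs[OF der], rule ext)
    fix h :: "(real^('n+'v)^('n+'v)) \<times> (real^('n+'v)^('n+'v)) \<times> (real^('v+'m)^'v)"
    show "trace (M ** (b ** transpose (db (snd (snd h))) + db (snd (snd h)) ** transpose b)
          + fst (snd h) ** BB B X)
        + trace (W ** (transpose F ** fst (snd h) + transpose (dF (snd (snd h))) ** M
            + (M ** dF (snd (snd h)) + fst (snd h) ** F)) + fst h ** ?R1)
        = (?R1, ?R2, 2 *\<^sub>R ?R3) \<bullet> h"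
      \<comment> \<open>The inner product on triples is split by component and each component is
        turned back into traces; after expansion both sides have the same summands.\<close>
      unfolding inner_prod_def fst_conv snd_conv
        dX[of "snd (snd h)", symmetric] dM[of "fst (snd h)", symmetric] dW[of "fst h", symmetric]
      by (simp only: linear_add[OF bounded_linear.linear[OF bounded_linear_trace]] matrix_add_ldistrib)
  qed
  with mem show ?thesis
    by (simp add: has_gradient_on_def)
qed

theorem theorem3p2:
  fixes A :: "real^'n^'n" and B :: "real^'m^'n" and C :: "real^'n^'p"
    and L :: "real^'v^'m" and P :: "real^'v^'n"
    and s :: "'v \<Rightarrow> complex" and l :: "'v \<Rightarrow> real^'m" and T :: "complex^'v^'v"
    and W M :: "real^('n+'v)^('n+'v)" and X :: "real^('v+'m)^'v"
  assumes "minimal_realization A B C"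
    and "stable_matrix A"
    and "\<forall>j. s j \<notin> spectrum A"
    and "cmat P = krylov A B s l ** T"
    and "invertible T"
    and "W \<in> sym_matrices"
    and "M \<in> sym_matrices"
  shows "grad_lagrangian A B C L P (W, M, X) = 0 \<longleftrightarrow>
      transpose (AA A L X) ** M + M ** AA A L X + CC C P = 0 \<and>
      AA A L X ** W + W ** transpose (AA A L X) + BB B X = 0 \<and>
      transpose (block12 M) ** B ** transpose EE + block22 M ** X ** EE ** transpose EE
        + transpose (block12 M) ** block12 W ** transpose (LL L)
        + block22 M ** block22 W ** transpose (LL L) = 0"
proof -
  have S: "subspace (sym_matrices \<times> sym_matrices \<times> UNIV ::
      ((real^('n+'v)^('n+'v)) \<times> (real^('n+'v)^('n+'v)) \<times> (real^('v+'m)^'v)) set)"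
    by (intro subspace_Times subspace_sym_matrices subspace_UNIV)
  note grad = has_gradient_on_lagrangian[OF assms(6,7), of A B C L P X]
  have "grad_lagrangian A B C L P (W, M, X) =
      (transpose (AA A L X) ** M + M ** AA A L X + CC C P,
       AA A L X ** W + W ** transpose (AA A L X) + BB B X,
       2 *\<^sub>R (transpose (block12 M) ** B ** transpose EE + block22 M ** X ** EE ** transpose EE
        + transpose (block12 M) ** block12 W ** transpose (LL L)
        + block22 M ** block22 W ** transpose (LL L)))"
    \<comment> \<open>The definite description is resolved by the explicit gradient and the
      uniqueness of gradients on a subspace.\<close>
    unfolding gradient_on_def
    by (rule the_equality[where P = "has_gradient_on _ _ _", OF grad
          has_gradient_on_unique[OF S _ _ grad]]) (use assms(6,7) in auto)
  \<comment> \<open>A triple vanishes componentwise, and the nonzero factor 2 cancels.\<close>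
  then show ?thesis
    by (simp add: zero_prod_def)
qed

end
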